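(* Let $\chi$ be a binary position of birthday at most $2$. Then the misère monoid $\mathcal{M}_{\mathrm{cl}(\chi,\overline{\chi})}$ is infinite if and only if at least one of the positions $1$, $\overline{1}$, $\rho$, $\overline{\rho}$ lies in $\mathrm{cl}(\chi,\overline{\chi})$.
   Context: A position $\xi=\{\xi^L \mid \xi^R\}$ is given recursively by finite sets of Left and Right options; $\cdot$ denotes an empty set. $0=\{\cdot\mid\cdot\}$ (birthday $0$); the birthday of a position is $1$ plus the maximum birthday of its options. $*=\{0\mid0\}$, $1=\{0\mid\cdot\}$, $\overline{1}=\{\cdot\mid0\}$, $\rho=\{*\mid0\}$, $\overline{\rho}=\{0\mid *\}$. A position is binary if from every position in its game tree each player has at most one option. The conjugate is $\overline{\xi}=\{\overline{\xi^R}\mid\overline{\xi^L}\}$. Disjunctive sum: $\alpha+\beta=\{\alpha^L+\beta,\alpha+\beta^L \mid \alpha^R+\beta,\alpha+\beta^R\}$. Under misère play a player unable to move on their turn wins; $o^-$ denotes misère outcome ($\mathcal{L}$, $\mathcal{R}$, $\mathcal{N}$ next player wins, $\mathcal{P}$ next player loses). $\mathrm{cl}(\alpha,\beta)$ is the smallest set containing $\alpha,\beta$ closed under disjunctive sum and taking options. For closed $\Gamma$, $\alpha\equiv\beta\pmod\Gamma$ iff $o^-(\alpha+\gamma)=o^-(\beta+\gamma)$ for all $\gamma\in\Gamma$; the misère monoid $\mathcal{M}_\Gamma$ is the set of $\equiv$-classes with the monoid operation induced by disjunctive sum. *)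

theory Defs
  imports "HOL-Library.FSet" "HOL-Algebra.Group"
begin

(* Positions are compared as forms: two positions are equal iff they have the same
   sets of Left and of Right options. *)
datatype position =
  Position (left_opts: "position fset") (right_opts: "position fset")

lemma size_left_opt [simp]:
  assumes "h |\<in>| left_opts g"
  shows "size h < size g"
proof (cases g)
  case (Position L R)
  have "Suc (size h) \<le> (\<Sum>x\<in>fset L. Suc (size x))"
    using assms Position by (intro member_le_sum) auto
  then show ?thesis
    by (simp add: Position)
qed

lemma size_right_opt [simp]:
  assumes "h |\<in>| right_opts g"
  shows "size h < size g"
proof (cases g)
  case (Position L R)
  have "Suc (size h) \<le> (\<Sum>x\<in>fset R. Suc (size x))"
    using assms Position by (intro member_le_sum) auto
  then show ?thesis
    by (simp add: Position)
qed

primrec birthday :: "position \<Rightarrow> nat" where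
  "birthday (Position L R) =
     (if L |\<union>| R = {||} then 0
      else 1 + fMax ((birthday |`| L) |\<union>| (birthday |`| R)))"

inductive_set game_tree :: "position \<Rightarrow> position set" for g where
  root: "g \<in> game_tree g"
| left: "h \<in> game_tree g \<Longrightarrow> k |\<in>| left_opts h \<Longrightarrow> k \<in> game_tree g"
| right: "h \<in> game_tree g \<Longrightarrow> k |\<in>| right_opts h \<Longrightarrow> k \<in> game_tree g"

definition binary :: "position \<Rightarrow> bool" where
  "binary g \<longleftrightarrow>
     (\<forall>h\<in>game_tree g. fcard (left_opts h) \<le> 1 \<and> fcard (right_opts h) \<le> 1)"

primrec conjugate :: "position \<Rightarrow> position" where
  "conjugate (Position L R) = Position (conjugate |`| R) (conjugate |`| L)"

function disj_sum :: "position \<Rightarrow> position \<Rightarrow> position" where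
  "disj_sum a b = Position
     (((\<lambda>a'. disj_sum a' b) |`| left_opts a) |\<union>| (disj_sum a |`| left_opts b))
     (((\<lambda>a'. disj_sum a' b) |`| right_opts a) |\<union>| (disj_sum a |`| right_opts b))"
  by pat_completeness auto
termination
  by (relation "measure (\<lambda>(a, b). size a + size b)") auto

declare disj_sum.simps [simp del]

instantiation position :: comm_monoid_add
begin

definition zero_position_def: "0 = Position {||} {||}"

definition plus_position_def: "a + b = disj_sum a b"

lemma left_opts_plus:
  "left_opts (a + b) = ((\<lambda>a'. a' + b) |`| left_opts a) |\<union>| ((+) a |`| left_opts b)"
  unfolding plus_position_def by (subst disj_sum.simps) simp

lemma right_opts_plus:
  "right_opts (a + b) = ((\<lambda>a'. a' + b) |`| right_opts a) |\<union>| ((+) a |`| right_opts b)"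
  unfolding plus_position_def by (subst disj_sum.simps) simp

instance
proof
  fix a b c :: position
  show "a + b + c = a + (b + c)"
  proof (induction "size a + size b + size c" arbitrary: a b c rule: less_induct)
    case less
    have "left_opts (a + b + c) = left_opts (a + (b + c))"
    proof -
      have "(\<lambda>x. x + b + c) |`| left_opts a = (\<lambda>x. x + (b + c)) |`| left_opts a"
        by (rule fset.map_cong[OF refl]) (rule less, simp)
      moreover have "(\<lambda>x. a + x + c) |`| left_opts b = (\<lambda>x. a + (x + c)) |`| left_opts b"
        by (rule fset.map_cong[OF refl]) (rule less, simp)
      moreover have "(\<lambda>x. a + b + x) |`| left_opts c = (\<lambda>x. a + (b + x)) |`| left_opts c"
        by (rule fset.map_cong[OF refl]) (rule less, simp)
      ultimately show ?thesis
        by (simp only: left_opts_plus fimage_funion fset.map_comp comp_def funion_assoc)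
    qed
    moreover
    have "right_opts (a + b + c) = right_opts (a + (b + c))"
    proof -
      have "(\<lambda>x. x + b + c) |`| right_opts a = (\<lambda>x. x + (b + c)) |`| right_opts a"
        by (rule fset.map_cong[OF refl]) (rule less, simp)
      moreover have "(\<lambda>x. a + x + c) |`| right_opts b = (\<lambda>x. a + (x + c)) |`| right_opts b"
        by (rule fset.map_cong[OF refl]) (rule less, simp)
      moreover have "(\<lambda>x. a + b + x) |`| right_opts c = (\<lambda>x. a + (b + x)) |`| right_opts c"
        by (rule fset.map_cong[OF refl]) (rule less, simp)
      ultimately show ?thesis
        by (simp only: right_opts_plus fimage_funion fset.map_comp comp_def funion_assoc)
    qed
    ultimately show ?case
      by (intro position.expand conjI)
  qed
next
  fix a b :: position
  show "a + b = b + a"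
  proof (induction "size a + size b" arbitrary: a b rule: less_induct)
    case less
    have "left_opts (a + b) = left_opts (b + a)"
    proof -
      have "(\<lambda>x. x + b) |`| left_opts a = (\<lambda>x. b + x) |`| left_opts a"
        by (rule fset.map_cong[OF refl]) (rule less, simp)
      moreover have "(\<lambda>x. a + x) |`| left_opts b = (\<lambda>x. x + a) |`| left_opts b"
        by (rule fset.map_cong[OF refl]) (rule less, simp)
      ultimately show ?thesis
        by (simp only: left_opts_plus funion_commute)
    qed
    moreover
    have "right_opts (a + b) = right_opts (b + a)"
    proof -
      have "(\<lambda>x. x + b) |`| right_opts a = (\<lambda>x. b + x) |`| right_opts a"
        by (rule fset.map_cong[OF refl]) (rule less, simp)
      moreover have "(\<lambda>x. a + x) |`| right_opts b = (\<lambda>x. x + a) |`| right_opts b"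
        by (rule fset.map_cong[OF refl]) (rule less, simp)
      ultimately show ?thesis
        by (simp only: right_opts_plus funion_commute)
    qed
    ultimately show ?case
      by (intro position.expand conjI)
  qed
next
  fix a :: position
  show "0 + a = a"
  proof (induction "size a" arbitrary: a rule: less_induct)
    case less
    have "left_opts (0 + a) = left_opts a"
    proof -
      have "(\<lambda>x. 0 + x) |`| left_opts a = (\<lambda>x. x) |`| left_opts a"
        by (rule fset.map_cong[OF refl]) (rule less, simp)
      then show ?thesis
        by (simp only: left_opts_plus fset.map_ident) (simp add: zero_position_def)
    qed
    moreover
    have "right_opts (0 + a) = right_opts a"
    proof -
      have "(\<lambda>x. 0 + x) |`| right_opts a = (\<lambda>x. x) |`| right_opts a"
        by (rule fset.map_cong[OF refl]) (rule less, simp)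
      then show ?thesis
        by (simp only: right_opts_plus fset.map_ident) (simp add: zero_position_def)
    qed
    ultimately show ?case
      by (intro position.expand conjI)
  qed
qed

end

definition pos_star :: position where
  "pos_star = Position {|0|} {|0|}"

definition pos_one :: position where
  "pos_one = Position {|0|} {||}"

definition pos_one_bar :: position where
  "pos_one_bar = Position {||} {|0|}"

definition pos_rho :: position where
  "pos_rho = Position {|pos_star|} {|0|}"

definition pos_rho_bar :: position where
  "pos_rho_bar = Position {|0|} {|pos_star|}"

datatype player = Left_player | Right_player

fun opponent :: "player \<Rightarrow> player" where
  "opponent Left_player = Right_player"
| "opponent Right_player = Left_player"

fun opts :: "player \<Rightarrow> position \<Rightarrow> position fset" where
  "opts Left_player g = left_opts g"
| "opts Right_player g = right_opts g"

lemma size_opts [simp]: "h |\<in>| opts p g \<Longrightarrow> size h < size g"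
  by (cases p) auto

(* The player p, moving first in g, wins under misere play. *)
function wins_first :: "player \<Rightarrow> position \<Rightarrow> bool" where
  "wins_first p g \<longleftrightarrow>
     opts p g = {||} \<or> (\<exists>h |\<in>| opts p g. \<not> wins_first (opponent p) h)"
  by pat_completeness auto
termination
  by (relation "measure (\<lambda>(p, g). size g)") auto

declare wins_first.simps [simp del]

datatype outcome = Outcome_L | Outcome_R | Outcome_N | Outcome_P

definition misere_outcome :: "position \<Rightarrow> outcome" where
  "misere_outcome g =
     (if wins_first Left_player g
      then (if wins_first Right_player g then Outcome_N else Outcome_L)
      else (if wins_first Right_player g then Outcome_R else Outcome_P))"

inductive_set cl :: "position \<Rightarrow> position \<Rightarrow> position set" for a b where
  gen1: "a \<in> cl a b"
| gen2: "b \<in> cl a b"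
| sum: "g \<in> cl a b \<Longrightarrow> h \<in> cl a b \<Longrightarrow> g + h \<in> cl a b"
| left_opt: "g \<in> cl a b \<Longrightarrow> h |\<in>| left_opts g \<Longrightarrow> h \<in> cl a b"
| right_opt: "g \<in> cl a b \<Longrightarrow> h |\<in>| right_opts g \<Longrightarrow> h \<in> cl a b"

definition indistinguishable :: "position set \<Rightarrow> position \<Rightarrow> position \<Rightarrow> bool" where
  "indistinguishable \<Gamma> a b \<longleftrightarrow>
     (\<forall>c\<in>\<Gamma>. misere_outcome (a + c) = misere_outcome (b + c))"

definition indist_rel :: "position set \<Rightarrow> (position \<times> position) set" where
  "indist_rel \<Gamma> = {(a, b). a \<in> \<Gamma> \<and> b \<in> \<Gamma> \<and> indistinguishable \<Gamma> a b}"

definition misere_monoid :: "position set \<Rightarrow> position set monoid" where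
  "misere_monoid \<Gamma> =
     \<lparr>carrier = \<Gamma> // indist_rel \<Gamma>,
      monoid.mult = (\<lambda>A B. \<Union>a\<in>A. \<Union>b\<in>B. indist_rel \<Gamma> `` {a + b}),
      one = indist_rel \<Gamma> `` {0}\<rparr>"

lemma equiv_indist_rel: "equiv \<Gamma> (indist_rel \<Gamma>)"
  by (intro equivI refl_onI symI transI) (auto simp: indist_rel_def indistinguishable_def)

lemma zero_in_cl: "0 \<in> cl a b"
proof -
  have "g \<in> cl a b \<Longrightarrow> 0 \<in> cl a b" for g
  proof (induction "size g" arbitrary: g rule: less_induct)
    case less
    show ?case
    proof (cases "\<exists>h. h |\<in>| left_opts g |\<union>| right_opts g")
      case True
      with less show ?thesis
        by (metis funion_iff cl.left_opt cl.right_opt size_left_opt size_right_opt)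
    next
      case False
      then have "g = 0"
        by (cases g) (auto simp: zero_position_def)
      with less show ?thesis by simp
    qed
  qed
  then show ?thesis using cl.gen1 by blast
qed

lemma indist_rel_plus:
  assumes closed: "\<And>x y. x \<in> \<Gamma> \<Longrightarrow> y \<in> \<Gamma> \<Longrightarrow> x + y \<in> \<Gamma>"
    and "(a, a') \<in> indist_rel \<Gamma>" "(b, b') \<in> indist_rel \<Gamma>"
  shows "(a + b, a' + b') \<in> indist_rel \<Gamma>"
proof -
  have "misere_outcome (a + b + c) = misere_outcome (a' + b' + c)" if c: "c \<in> \<Gamma>" for c
  proof -
    have "misere_outcome (a + (b + c)) = misere_outcome (a' + (b + c))"
      using assms c by (auto simp: indist_rel_def indistinguishable_def)
    also have "\<dots> = misere_outcome (b + (a' + c))"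
      by (simp add: ac_simps)
    also have "\<dots> = misere_outcome (b' + (a' + c))"
      using assms c by (auto simp: indist_rel_def indistinguishable_def)
    finally show ?thesis by (simp add: ac_simps)
  qed
  then show ?thesis
    using assms by (auto simp: indist_rel_def indistinguishable_def)
qed

lemma misere_monoid_mult:
  assumes closed: "\<And>x y. x \<in> \<Gamma> \<Longrightarrow> y \<in> \<Gamma> \<Longrightarrow> x + y \<in> \<Gamma>"
    and "a \<in> \<Gamma>" "b \<in> \<Gamma>"
  shows "indist_rel \<Gamma> `` {a} \<otimes>\<^bsub>misere_monoid \<Gamma>\<^esub> indist_rel \<Gamma> `` {b} = indist_rel \<Gamma> `` {a + b}"
proof -
  note eq = equiv_indist_rel[of \<Gamma>]
  have *: "indist_rel \<Gamma> `` {a' + b'} = indist_rel \<Gamma> `` {a + b}"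
    if "a' \<in> indist_rel \<Gamma> `` {a}" "b' \<in> indist_rel \<Gamma> `` {b}" for a' b'
  proof -
    have "(a + b, a' + b') \<in> indist_rel \<Gamma>"
      using that by (intro indist_rel_plus[OF closed]) blast+
    from equiv_class_eq[OF eq this] show ?thesis ..
  qed
  have "a \<in> indist_rel \<Gamma> `` {a}" "b \<in> indist_rel \<Gamma> `` {b}"
    using equiv_class_self[OF eq] assms(2,3) by blast+
  with * show ?thesis
    unfolding misere_monoid_def monoid.simps by blast
qed

lemma comm_monoid_misere_monoid: "comm_monoid (misere_monoid (cl a b))"
proof -
  let ?\<Gamma> = "cl a b"
  let ?cls = "\<lambda>x. indist_rel ?\<Gamma> `` {x}"
  have carr: "carrier (misere_monoid ?\<Gamma>) = ?cls ` ?\<Gamma>"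
    by (auto simp: misere_monoid_def quotient_def)
  have one: "\<one>\<^bsub>misere_monoid ?\<Gamma>\<^esub> = ?cls 0"
    by (simp add: misere_monoid_def)
  have mult: "?cls x \<otimes>\<^bsub>misere_monoid ?\<Gamma>\<^esub> ?cls y = ?cls (x + y)" if "x \<in> ?\<Gamma>" "y \<in> ?\<Gamma>" for x y
    using that by (intro misere_monoid_mult cl.sum)
  show ?thesis
  proof (rule comm_monoidI; unfold carr one)
    show "?cls 0 \<in> ?cls ` ?\<Gamma>"
      using zero_in_cl by (rule imageI)
  next
    fix x y assume "x \<in> ?cls ` ?\<Gamma>" "y \<in> ?cls ` ?\<Gamma>"
    then show "x \<otimes>\<^bsub>misere_monoid ?\<Gamma>\<^esub> y \<in> ?cls ` ?\<Gamma>"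
      by (elim imageE) (simp only: mult, rule imageI, rule cl.sum)
  qed (elim imageE; simp only: mult cl.sum zero_in_cl ac_simps add_0_left add_0_right)+
qed

end

theory Submission
  imports Defs
begin

text \<open>
  If $1$ or $\rho$ lies in the closure, so does its conjugate, and the multiples of the one are
  pairwise separated by the multiples of the other: the outcome of $a \cdot \rho + b \cdot
  \overline{\rho}$ is $\mathcal{N}$ exactly when $a = b$, and likewise for $1$.
  Otherwise $\chi$ is one of $0$, $*$, $\{*\mid*\}$, $\{*\mid\cdot\}$, $\{\cdot\mid*\}$, and all
  positions of the closure have a parity that alternates along moves, odd positions always offering
  a move to both players. The player to move then wins precisely the even positions, so the parity
  determines the class in the monoid.
\<close>

section \<open>Options of sums and conjugates\<close>

lemma opts_zero [simp]: "opts p 0 = {||}"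
  by (cases p) (simp_all add: zero_position_def)

lemma opts_plus:
  "opts p (a + b) = ((\<lambda>a'. a' + b) |`| opts p a) |\<union>| ((+) a |`| opts p b)"
  by (cases p) (simp_all only: opts.simps left_opts_plus right_opts_plus)

lemma opponent_opponent [simp]: "opponent (opponent p) = p"
  by (cases p) simp_all

lemma opts_conjugate: "opts p (conjugate g) = conjugate |`| opts (opponent p) g"
  by (cases g; cases p) simp_all

text \<open>Treating the player as a variable lets one argument serve for both option sets.\<close>

lemma position_eqI:
  assumes "\<And>p. opts p g = opts p h"
  shows "g = h"
  using assms[of Left_player] assms[of Right_player] by (simp add: position.expand)

lemma conjugate_conjugate [simp]: "conjugate (conjugate g) = g"
proof (induction "size g" arbitrary: g rule: less_induct)
  case less
  have "(\<lambda>h. conjugate (conjugate h)) |`| opts p g = (\<lambda>h. h) |`| opts p g" for p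
    by (rule fset.map_cong[OF refl]) (simp add: less)
  then show ?case
    by (intro position_eqI) (simp add: opts_conjugate fset.map_comp comp_def)
qed

lemma conjugate_plus: "conjugate (g + h) = conjugate g + conjugate h"
proof (induction "size g + size h" arbitrary: g h rule: less_induct)
  case less
  have "(\<lambda>x. conjugate (x + h)) |`| opts p g = (\<lambda>x. conjugate x + conjugate h) |`| opts p g" for p
    by (rule fset.map_cong[OF refl]) (simp add: less)
  moreover have
    "(\<lambda>x. conjugate (g + x)) |`| opts p h = (\<lambda>x. conjugate g + conjugate x) |`| opts p h" for p
    by (rule fset.map_cong[OF refl]) (simp add: less)
  ultimately show ?case
    by (intro position_eqI)
      (simp add: opts_conjugate opts_plus fimage_funion fset.map_comp comp_def)
qed

lemma cl_opts: "g \<in> cl a b \<Longrightarrow> h |\<in>| opts p g \<Longrightarrow> h \<in> cl a b"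
  by (cases p) (auto intro: cl.left_opt cl.right_opt)

text \<open>The generators are conjugates of each other, and conjugation commutes with sums and
  swaps the two players' options.\<close>

lemma conjugate_in_cl:
  assumes "g \<in> cl a (conjugate a)"
  shows "conjugate g \<in> cl a (conjugate a)"
  using assms
proof induction
  case (left_opt g h)
  then have "conjugate h |\<in>| opts Right_player (conjugate g)"
    by (simp add: opts_conjugate)
  with left_opt.IH show ?case by (rule cl_opts)
next
  case (right_opt g h)
  then have "conjugate h |\<in>| opts Left_player (conjugate g)"
    by (simp add: opts_conjugate)
  with right_opt.IH show ?case by (rule cl_opts)
qed (auto simp: conjugate_plus intro: cl.intros)

section \<open>Parity and finite monoids\<close>

text \<open>\<open>True\<close> stands for odd. Only odd positions must offer both players a move;
  an even one may leave either player stuck.\<close>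

inductive has_parity :: "bool \<Rightarrow> position \<Rightarrow> bool" where
  has_parityI: "(\<And>p h. h |\<in>| opts p g \<Longrightarrow> has_parity (\<not> odd_pos) h) \<Longrightarrow>
    (\<And>p. odd_pos \<Longrightarrow> opts p g \<noteq> {||}) \<Longrightarrow> has_parity odd_pos g"

lemma has_parity_opts: "has_parity c g \<Longrightarrow> h |\<in>| opts p g \<Longrightarrow> has_parity (\<not> c) h"
  by (auto elim: has_parity.cases)

lemma has_parity_odd_nonempty: "has_parity True g \<Longrightarrow> opts p g \<noteq> {||}"
  by (auto elim: has_parity.cases)

text \<open>A move changes one summand and flips its parity. If the sum is odd, one summand is odd
  and supplies a move to either player.\<close>

lemma has_parity_plus:
  assumes "has_parity c g" "has_parity d h"
  shows "has_parity (c \<noteq> d) (g + h)"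
  using assms
proof (induction "size g + size h" arbitrary: g h c d rule: less_induct)
  case less
  show ?case
  proof (rule has_parityI)
    fix p k assume "k |\<in>| opts p (g + h)"
    then consider g' where "g' |\<in>| opts p g" "k = g' + h" | h' where "h' |\<in>| opts p h" "k = g + h'"
      by (auto simp: opts_plus)
    then show "has_parity (\<not> (c \<noteq> d)) k"
    proof cases
      case 1
      then have "has_parity ((\<not> c) \<noteq> d) k"
        using less.hyps[of g' h "\<not> c" d] less.prems has_parity_opts[of c g g' p] by simp
      then show ?thesis by (cases c; cases d) simp_all
    next
      case 2
      then have "has_parity (c \<noteq> (\<not> d)) k"
        using less.hyps[of g h' c "\<not> d"] less.prems has_parity_opts[of d h h' p] by simp
      then show ?thesis by (cases c; cases d) simp_all
    qed
  next
    fix p assume "c \<noteq> d"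
    then have "has_parity True g \<or> has_parity True h"
      using less.prems by (cases c; cases d) simp_all
    then show "opts p (g + h) \<noteq> {||}"
      using has_parity_odd_nonempty[of g p] has_parity_odd_nonempty[of h p]
      by (auto simp: opts_plus)
  qed
qed

lemma has_parity_conjugate: "has_parity c g \<Longrightarrow> has_parity c (conjugate g)"
proof (induction rule: has_parity.induct)
  case (has_parityI g c)
  show ?case
    by (rule has_parity.has_parityI) (use has_parityI in \<open>auto simp: opts_conjugate\<close>)
qed

text \<open>At an even position the mover either is stuck, which wins under misere play, or hands
  over an odd position. At an odd position a move exists and every move hands over an even
  one.\<close>

lemma wins_first_iff_even:
  assumes "has_parity c g"
  shows "wins_first p g \<longleftrightarrow> \<not> c"
  using assms
proof (induction arbitrary: p rule: has_parity.induct)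
  case (has_parityI g c)
  then have "wins_first (opponent p) h \<longleftrightarrow> c" if "h |\<in>| opts p g" for h
    using that by simp
  with has_parityI.hyps(2)[of p] show ?case
    by (subst wins_first.simps) blast
qed

lemma cl_has_parity:
  assumes "has_parity c a" "has_parity d b" "g \<in> cl a b"
  shows "\<exists>e. has_parity e g"
  using assms(3)
proof induction
  case (left_opt g h)
  then show ?case using has_parity_opts[of _ g h Left_player] by auto
next
  case (right_opt g h)
  then show ?case using has_parity_opts[of _ g h Right_player] by auto
next
  case (sum g h)
  then show ?case using has_parity_plus[of _ g _ h] by blast
qed (use assms(1,2) in blast)+

text \<open>Adding a fixed position to two positions of equal parity gives sums of equal parity,
  hence of equal outcome. There are thus at most two classes.\<close>

lemma finite_misere_monoid_if_parity:
  assumes "has_parity c a" "has_parity d b"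
  shows "finite (carrier (misere_monoid (cl a b)))"
proof -
  let ?\<Gamma> = "cl a b"
  let ?cls = "\<lambda>x. indist_rel ?\<Gamma> `` {x}"
  have cls_eq: "?cls x = ?cls y"
    if "x \<in> ?\<Gamma>" "y \<in> ?\<Gamma>" "has_parity e x" "has_parity e y" for x y e
  proof -
    have "misere_outcome (x + z) = misere_outcome (y + z)" if z: "z \<in> ?\<Gamma>" for z
    proof -
      obtain f where "has_parity f z" using cl_has_parity[OF assms z] by blast
      with \<open>has_parity e x\<close> \<open>has_parity e y\<close>
      have "has_parity (e \<noteq> f) (x + z)" "has_parity (e \<noteq> f) (y + z)"
        by (blast intro: has_parity_plus)+
      then show ?thesis by (simp add: misere_outcome_def wins_first_iff_even)
    qed
    then have "(x, y) \<in> indist_rel ?\<Gamma>"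
      using that by (simp add: indist_rel_def indistinguishable_def)
    then show ?thesis by (rule equiv_class_eq[OF equiv_indist_rel])
  qed
  \<comment> \<open>\<open>F\<close> picks a class for each parity. A parity that does not occur
    gets a junk value, which is harmless: only the inclusion of the carrier in the finite set
    \<open>range F\<close> is needed.\<close>
  define F where "F e = ?cls (SOME x. x \<in> ?\<Gamma> \<and> has_parity e x)" for e
  have "?cls x \<in> range F" if x: "x \<in> ?\<Gamma>" for x
  proof -
    obtain e where e: "has_parity e x" using cl_has_parity[OF assms x] by blast
    have "F e = ?cls x"
      unfolding F_def using someI[of "\<lambda>x. x \<in> ?\<Gamma> \<and> has_parity e x", OF conjI[OF x e]] x e
      by (intro cls_eq) simp_all
    then show ?thesis by blast
  qed
  then have "carrier (misere_monoid ?\<Gamma>) \<subseteq> range F"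
    by (auto simp: misere_monoid_def quotient_def)
  then show ?thesis by (rule finite_subset) simp
qed

section \<open>Multiples and infinite monoids\<close>

definition copies :: "nat \<Rightarrow> position \<Rightarrow> position" where
  "copies n g = sum_list (replicate n g)"

lemma copies_0 [simp]: "copies 0 g = 0"
  by (simp add: copies_def)

lemma copies_Suc: "copies (Suc n) g = g + copies n g"
  by (simp add: copies_def)

text \<open>Moving in any one of several equal summands gives the same form, so the options coming
  from different copies coincide.\<close>

lemma opts_copies_Suc: "opts p (copies (Suc n) g) = (\<lambda>h. h + copies n g) |`| opts p g"
proof (induction n)
  case (Suc n)
  have "(+) g |`| opts p (copies (Suc n) g) = (\<lambda>h. h + copies (Suc n) g) |`| opts p g"
    unfolding Suc by (simp add: fset.map_comp comp_def copies_Suc ac_simps)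
  then show ?case
    by (subst copies_Suc, subst opts_plus) simp
qed (simp add: copies_Suc)

lemma copies_in_cl: "g \<in> cl a b \<Longrightarrow> copies n g \<in> cl a b"
  by (induction n) (auto simp: copies_Suc zero_in_cl intro: cl.sum)

text \<open>The position \<open>g n\<close> tells \<open>f n\<close> from every other
  \<open>f m\<close>, so the classes of the \<open>f n\<close> are pairwise distinct.\<close>

lemma infinite_misere_monoid_if_separated:
  assumes f: "\<And>n::nat. f n \<in> \<Gamma>" and g: "\<And>n. g n \<in> \<Gamma>"
    and N: "\<And>m n. misere_outcome (f m + g n) = Outcome_N \<longleftrightarrow> m = n"
  shows "infinite (carrier (misere_monoid \<Gamma>))"
proof -
  let ?cls = "\<lambda>n. indist_rel \<Gamma> `` {f n}"
  have "inj ?cls"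
  proof (rule injI)
    fix m n assume "?cls m = ?cls n"
    then have "(f m, f n) \<in> indist_rel \<Gamma>"
      by (rule eq_equiv_class[OF _ equiv_indist_rel f])
    then have "misere_outcome (f m + g n) = misere_outcome (f n + g n)"
      using g by (simp add: indist_rel_def indistinguishable_def)
    then show "m = n" using N by metis
  qed
  then have "infinite (range ?cls)" by (simp add: finite_image_iff)
  moreover have "range ?cls \<subseteq> carrier (misere_monoid \<Gamma>)"
    using f by (auto simp: misere_monoid_def quotient_def)
  ultimately show ?thesis using infinite_super by blast
qed

lemma opts_one:
  "opts Left_player pos_one = {|0|}" "opts Right_player pos_one = {||}"
  "opts Left_player pos_one_bar = {||}" "opts Right_player pos_one_bar = {|0|}"
  by (simp_all add: pos_one_def pos_one_bar_def)

lemma opts_star: "opts p pos_star = {|0|}"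
  by (cases p) (simp_all add: pos_star_def)

lemma opts_rho:
  "opts Left_player pos_rho = {|pos_star|}" "opts Right_player pos_rho = {|0|}"
  "opts Left_player pos_rho_bar = {|0|}" "opts Right_player pos_rho_bar = {|pos_star|}"
  by (simp_all add: pos_rho_def pos_rho_bar_def)

text \<open>Only Left can play on \<open>pos_one\<close> and only Right on
  \<open>pos_one_bar\<close>, so the play is a race to run out of moves, and the mover wins
  ties.\<close>

lemma wins_first_copies_one:
  "(wins_first Left_player (copies a pos_one + copies b pos_one_bar) \<longleftrightarrow> a \<le> b) \<and>
   (wins_first Right_player (copies a pos_one + copies b pos_one_bar) \<longleftrightarrow> b \<le> a)"
proof (induction "a + b" arbitrary: a b rule: less_induct)
  case less
  have "wins_first Left_player (copies a pos_one + copies b pos_one_bar) \<longleftrightarrow> a \<le> b"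
  proof (cases a)
    case 0
    then show ?thesis
      by (cases b; subst wins_first.simps) (simp_all add: opts_plus opts_copies_Suc opts_one del: opts.simps)
  next
    case (Suc a')
    then have "opts Left_player (copies a pos_one + copies b pos_one_bar) =
        {|copies a' pos_one + copies b pos_one_bar|}"
      by (cases b) (simp_all add: opts_plus opts_copies_Suc opts_one del: opts.simps)
    then show ?thesis
      using less[of a' b] Suc by (subst wins_first.simps) auto
  qed
  moreover have "wins_first Right_player (copies a pos_one + copies b pos_one_bar) \<longleftrightarrow> b \<le> a"
  proof (cases b)
    case 0
    then show ?thesis
      by (cases a; subst wins_first.simps) (simp_all add: opts_plus opts_copies_Suc opts_one del: opts.simps)
  next
    case (Suc b')
    then have "opts Right_player (copies a pos_one + copies b pos_one_bar) =
        {|copies a pos_one + copies b' pos_one_bar|}"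
      by (cases a) (simp_all add: opts_plus opts_copies_Suc opts_one del: opts.simps)
    then show ?thesis
      using less[of a b'] Suc by (subst wins_first.simps) auto
  qed
  ultimately show ?case ..
qed

text \<open>Copies of \<open>pos_star\<close> are included because moves on \<open>pos_rho\<close>
  and \<open>pos_rho_bar\<close> can create them; the family is then closed under options.\<close>

definition rho_sum :: "nat \<Rightarrow> nat \<Rightarrow> nat \<Rightarrow> position" where
  "rho_sum k a b = copies k pos_star + copies a pos_rho + copies b pos_rho_bar"

lemma opts_rho_sum:
  "opts Left_player (rho_sum k a b) =
     (if k = 0 then {||} else {|rho_sum (k - 1) a b|}) |\<union>|
     (if a = 0 then {||} else {|rho_sum (Suc k) (a - 1) b|}) |\<union>|
     (if b = 0 then {||} else {|rho_sum k a (b - 1)|})"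
  "opts Right_player (rho_sum k a b) =
     (if k = 0 then {||} else {|rho_sum (k - 1) a b|}) |\<union>|
     (if a = 0 then {||} else {|rho_sum k (a - 1) b|}) |\<union>|
     (if b = 0 then {||} else {|rho_sum (Suc k) a (b - 1)|})"
proof -
  have copies_shift: "copies k g + (g + y) = copies (Suc k) g + y"
    "copies k g + x + (g + y) = copies (Suc k) g + x + y" for g x y
    by (simp_all add: copies_Suc add_ac)
  have opts_copies: "opts p (copies n g) =
      (if n = 0 then {||} else (\<lambda>h. h + copies (n - 1) g) |`| opts p g)" for p n g
    by (cases n) (simp_all add: opts_copies_Suc)
  show
    "opts Left_player (rho_sum k a b) =
       (if k = 0 then {||} else {|rho_sum (k - 1) a b|}) |\<union>|
       (if a = 0 then {||} else {|rho_sum (Suc k) (a - 1) b|}) |\<union>|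
       (if b = 0 then {||} else {|rho_sum k a (b - 1)|})"
    "opts Right_player (rho_sum k a b) =
       (if k = 0 then {||} else {|rho_sum (k - 1) a b|}) |\<union>|
       (if a = 0 then {||} else {|rho_sum k (a - 1) b|}) |\<union>|
       (if b = 0 then {||} else {|rho_sum (Suc k) a (b - 1)|})"
    by (simp_all add: rho_sum_def opts_plus opts_copies opts_star opts_rho copies_shift
        del: opts.simps copies_0)
qed

text \<open>Every summand offers a move to both players, so a player is stuck only at the empty
  sum.\<close>

lemma wins_first_rho_sum_step:
  "wins_first Left_player (rho_sum k a b) \<longleftrightarrow>
     k = 0 \<and> a = 0 \<and> b = 0 \<or>
     0 < k \<and> \<not> wins_first Right_player (rho_sum (k - 1) a b) \<or>
     0 < a \<and> \<not> wins_first Right_player (rho_sum (Suc k) (a - 1) b) \<or>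
     0 < b \<and> \<not> wins_first Right_player (rho_sum k a (b - 1))"
  "wins_first Right_player (rho_sum k a b) \<longleftrightarrow>
     k = 0 \<and> a = 0 \<and> b = 0 \<or>
     0 < k \<and> \<not> wins_first Left_player (rho_sum (k - 1) a b) \<or>
     0 < a \<and> \<not> wins_first Left_player (rho_sum k (a - 1) b) \<or>
     0 < b \<and> \<not> wins_first Left_player (rho_sum (Suc k) a (b - 1))"
  by (subst wins_first.simps; auto simp: opts_rho_sum simp del: opts.simps)+

text \<open>The surplus \<open>s\<close> counts the summands on which the player to move moves to $0$, minus those on
  which the opponent does; the condition was read off from a table of small cases.\<close>
definition rho_win :: "nat \<Rightarrow> int \<Rightarrow> bool" where
  "rho_win k s \<longleftrightarrow> (if even k then s = 0 \<or> s = - 1 \<or> 3 \<le> s else - 3 \<le> s \<and> s \<noteq> 0)"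

text \<open>Let \<open>s\<close> be the mover's surplus. For even \<open>k\<close>, a winning move
  is to 0 on an own summand if \<open>s\<close> is at least 3, to a star if \<open>s = -1\<close>,
  and either on a star or to 0 if \<open>s = 0\<close>, unless the sum is empty. For odd
  \<open>k\<close>, it is on a star if \<open>s\<close> is -1, -2 or at least 2, to 0 if
  \<open>s = 1\<close>, and to a star if \<open>s = -3\<close>. The sign of \<open>s\<close> or the
  parity of \<open>k\<close> guarantees the summand used. For all other \<open>s\<close> every move
  hands over a winning value.\<close>

lemma wins_first_rho_sum:
  "(wins_first Left_player (rho_sum k a b) \<longleftrightarrow> rho_win k (int b - int a)) \<and>
   (wins_first Right_player (rho_sum k a b) \<longleftrightarrow> rho_win k (int a - int b))"
\<comment> \<open>The weight 2 makes the measure drop even when \<open>pos_rho\<close> or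
  \<open>pos_rho_bar\<close> turns into a star.\<close>
proof (induction "k + 2 * a + 2 * b" arbitrary: k a b rule: less_induct)
  case less
  have IH: "wins_first Left_player (rho_sum k' a' b') \<longleftrightarrow> rho_win k' (int b' - int a')"
    "wins_first Right_player (rho_sum k' a' b') \<longleftrightarrow> rho_win k' (int a' - int b')"
    if "k' + 2 * a' + 2 * b' < k + 2 * a + 2 * b" for k' a' b'
    using less[OF that] by blast+
  show ?case
    unfolding wins_first_rho_sum_step[of k a b]
    by (cases k; cases a; cases b; simp add: IH) (auto simp: rho_win_def)
qed

lemma infinite_misere_monoid_one:
  assumes "pos_one \<in> cl a b" "pos_one_bar \<in> cl a b"
  shows "infinite (carrier (misere_monoid (cl a b)))"
  using assms
  by (intro infinite_misere_monoid_if_separated[of "\<lambda>n. copies n pos_one" _ "\<lambda>n. copies n pos_one_bar"])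
    (auto intro: copies_in_cl simp: misere_outcome_def wins_first_copies_one)

lemma infinite_misere_monoid_rho:
  assumes "pos_rho \<in> cl a b" "pos_rho_bar \<in> cl a b"
  shows "infinite (carrier (misere_monoid (cl a b)))"
proof (rule infinite_misere_monoid_if_separated)
  fix m n
  have "copies m pos_rho + copies n pos_rho_bar = rho_sum 0 m n"
    by (simp add: rho_sum_def)
  then show "misere_outcome (copies m pos_rho + copies n pos_rho_bar) = Outcome_N \<longleftrightarrow> m = n"
    \<comment> \<open>Both players win moving first only if the surplus and its negative each are 0,
      -1 or at least 3, which forces the surplus to be 0.\<close>
    by (auto simp: misere_outcome_def wins_first_rho_sum rho_win_def)
qed (use assms in \<open>auto intro: copies_in_cl\<close>)

section \<open>Binary positions of birthday at most 2\<close>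

lemma birthday_opts_less:
  assumes "h |\<in>| opts p g"
  shows "birthday h < birthday g"
proof (cases g)
  case (Position L R)
  then have h: "h |\<in>| L |\<union>| R" using assms by (cases p) auto
  then have "birthday h \<le> fMax ((birthday |`| L) |\<union>| (birthday |`| R))"
    by (intro fMax_ge) auto
  then show ?thesis using h Position by auto
qed

lemma birthday_0: "birthday g = 0 \<Longrightarrow> g = 0"
  by (intro position_eqI) (use birthday_opts_less in fastforce)

text \<open>The tree is generated downwards from its root, so the first move is prepended by
  induction on the tree of \<open>h\<close>.\<close>

lemma game_tree_opts: "h |\<in>| opts p g \<Longrightarrow> k \<in> game_tree h \<Longrightarrow> k \<in> game_tree g"
  by (rotate_tac, induction rule: game_tree.induct; cases p)
    (auto intro: game_tree.intros)

lemma binary_opts: "binary g \<Longrightarrow> h |\<in>| opts p g \<Longrightarrow> binary h"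
  by (auto simp: binary_def dest: game_tree_opts)

lemma binary_opts_cases:
  assumes "binary g"
  obtains "opts p g = {||}" | h where "opts p g = {|h|}"
proof -
  have "fcard (opts p g) \<le> 1"
    using assms game_tree.root by (cases p) (auto simp: binary_def)
  then have "card (fset (opts p g)) = 0 \<or> card (fset (opts p g)) = 1"
    unfolding fcard.rep_eq by linarith
  then consider "fset (opts p g) = {}" | h where "fset (opts p g) = {h}"
    by (metis card_0_eq card_1_singletonE finite_fset)
  then show ?thesis
    by cases (auto intro: that simp flip: fset_inject)
qed

lemma binary_birthday_1:
  assumes "binary g" "birthday g \<le> 1"
  shows "g \<in> {0, pos_star, pos_one, pos_one_bar}"
proof -
  have "opts p g = {||} \<or> opts p g = {|0|}" for p
  proof (cases rule: binary_opts_cases[OF assms(1), of p])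
    case (2 h)
    then have "birthday h = 0" using birthday_opts_less[of h p g] assms(2) by simp
    with 2 show ?thesis by (simp add: birthday_0)
  qed simp
  from this[of Left_player] this[of Right_player] show ?thesis
    by (cases g) (auto simp: zero_position_def pos_star_def pos_one_def pos_one_bar_def)
qed

lemma has_parity_zero: "has_parity False 0"
  by (rule has_parityI) auto

lemma has_parity_star: "has_parity True pos_star"
  by (rule has_parityI) (auto simp: opts_star has_parity_zero simp del: opts.simps)

text \<open>Evenness does not require a move to exist, so this covers 0 and the one-sided positions
  as well.\<close>

lemma has_parity_if_opts_star:
  assumes "\<And>p. opts p g |\<subseteq>| {|pos_star|}"
  shows "has_parity False g"
  by (rule has_parityI) (use assms has_parity_star in \<open>auto simp del: opts.simps\<close>)

text \<open>Options lie in the closure, so only 0 and star can occur as options. Of the nine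
  resulting forms, four are excluded by hypothesis; star is odd, and the other four have no option
  but star.\<close>

lemma binary_birthday_2_has_parity:
  assumes "binary g" "birthday g \<le> 2"
    and no: "pos_one \<notin> cl g b" "pos_one_bar \<notin> cl g b" "pos_rho \<notin> cl g b" "pos_rho_bar \<notin> cl g b"
  shows "\<exists>c. has_parity c g"
proof -
  have "opts p g \<in> {{||}, {|0|}, {|pos_star|}}" for p
  proof (cases p rule: binary_opts_cases[OF assms(1)])
    case (2 h)
    then have "h \<in> {0, pos_star, pos_one, pos_one_bar}"
      using birthday_opts_less[of h p g] binary_opts[of g h p] assms(1,2)
      by (intro binary_birthday_1) auto
    moreover have "h \<in> cl g b" using 2 by (intro cl_opts[OF cl.gen1, of h p]) auto
    ultimately show ?thesis using 2 no by auto
  qed auto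
  note this[of Left_player] this[of Right_player]
  moreover have "g \<notin> {pos_one, pos_one_bar, pos_rho, pos_rho_bar}"
    using no cl.gen1[of g b] by auto
  ultimately consider "g = pos_star" | "left_opts g |\<subseteq>| {|pos_star|}" "right_opts g |\<subseteq>| {|pos_star|}"
    by (cases g)
      (auto simp: pos_star_def pos_one_def pos_one_bar_def pos_rho_def pos_rho_bar_def)
  then show ?thesis
  proof cases
    case 2
    then have "opts p g |\<subseteq>| {|pos_star|}" for p by (cases p) simp_all
    then show ?thesis using has_parity_if_opts_star by blast
  qed (use has_parity_star in blast)
qed

lemma conjugate_zero: "conjugate 0 = 0"
  by (simp add: zero_position_def)

lemma conjugate_star: "conjugate pos_star = pos_star"
  by (simp add: pos_star_def conjugate_zero)

lemma conjugate_one: "conjugate pos_one = pos_one_bar"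
  by (simp add: pos_one_def pos_one_bar_def conjugate_zero)

lemma conjugate_rho: "conjugate pos_rho = pos_rho_bar"
  by (simp add: pos_rho_def pos_rho_bar_def conjugate_zero conjugate_star)

theorem theorem3p2p3:
  fixes \<chi> :: position
  assumes "binary \<chi>" and "birthday \<chi> \<le> 2"
  shows "infinite (carrier (misere_monoid (cl \<chi> (conjugate \<chi>)))) \<longleftrightarrow>
    (pos_one \<in> cl \<chi> (conjugate \<chi>) \<or> pos_one_bar \<in> cl \<chi> (conjugate \<chi>) \<or>
     pos_rho \<in> cl \<chi> (conjugate \<chi>) \<or> pos_rho_bar \<in> cl \<chi> (conjugate \<chi>))"
proof -
  let ?\<Gamma> = "cl \<chi> (conjugate \<chi>)"
  \<comment> \<open>Membership is shared by conjugates, so the four alternatives reduce to two, and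
    each brings the partner needed for separation.\<close>
  have one: "pos_one \<in> ?\<Gamma> \<longleftrightarrow> pos_one_bar \<in> ?\<Gamma>"
    using conjugate_in_cl[of pos_one \<chi>] conjugate_in_cl[of pos_one_bar \<chi>]
    by (auto simp flip: conjugate_one)
  have rho: "pos_rho \<in> ?\<Gamma> \<longleftrightarrow> pos_rho_bar \<in> ?\<Gamma>"
    using conjugate_in_cl[of pos_rho \<chi>] conjugate_in_cl[of pos_rho_bar \<chi>]
    by (auto simp flip: conjugate_rho)
  have "finite (carrier (misere_monoid ?\<Gamma>))" if no: "pos_one \<notin> ?\<Gamma>" "pos_rho \<notin> ?\<Gamma>"
  proof -
    obtain c where c: "has_parity c \<chi>"
      using binary_birthday_2_has_parity[OF assms, of "conjugate \<chi>"] no one rho by blast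
    show ?thesis
      by (rule finite_misere_monoid_if_parity[OF c has_parity_conjugate[OF c]])
  qed
  moreover have "infinite (carrier (misere_monoid ?\<Gamma>))" if "pos_one \<in> ?\<Gamma>"
    using infinite_misere_monoid_one that one by simp
  moreover have "infinite (carrier (misere_monoid ?\<Gamma>))" if "pos_rho \<in> ?\<Gamma>"
    using infinite_misere_monoid_rho that rho by simp
  ultimately show ?thesis
    unfolding one[symmetric] rho[symmetric] by auto
qed

end
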